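(* (Slow regime, small arrival rates.) Let $\alpha\in(0,1)$, $\Delta>0$, $\mu>0$, $t>0$. Assume that $\Lambda$ takes values in a discrete set of positive values, of which $y$ is the largest, taken with probability $p\in(0,1)$, and $y'<y$ is the second largest. Let $u(t):=\frac{y}{\mu}(1-e^{-\mu t})$ and let $a>u(t)$. With $M^{(N)}(t)$ the queue length at time $t$ in the $N$-scaled system defined in the context, $$\lim_{N\to\infty}\frac1N\log\mathbb{P}\Big(\frac{M^{(N)}(t)}{N}\ge a\Big)=-\sup_{\theta>0}\big(\theta a-u(t)(e^\theta-1)\big)=a\log\Big(\frac{u(t)}{a}\Big)+a-u(t).$$
   Context: $\Lambda_0,\Lambda_1,\dots$ are i.i.d. copies of the random variable $\Lambda$. Define $$\Lambda^{(N)}(s):=\sum_{j=0}^\infty \Lambda_j\,1_{[j\Delta N^{-\alpha},(j+1)\Delta N^{-\alpha})}(s),\qquad \kappa_t(\Lambda^{(N)}):=\int_0^t\Lambda^{(N)}(s)\,e^{-\mu s}\,\mathrm{d}s .$$ $M^{(N)}(t)$, the number of jobs at time $t$ in an initially empty infinite-server queue with exponential service times of mean $1/\mu$ and random arrival rate $N\Lambda^{(N)}(\cdot)$, is the mixed Poisson random variable that, conditionally on $(\Lambda_j)_j$, is Poisson with parameter $N\kappa_t(\Lambda^{(N)})$. *)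

theory Defs
  imports "HOL-Probability.Probability"
begin

definition iid_copies :: "'a measure \<Rightarrow> (nat \<Rightarrow> 'a \<Rightarrow> real) \<Rightarrow> ('a \<Rightarrow> real) \<Rightarrow> bool" where
  "iid_copies M X Y \<longleftrightarrow>
     prob_space.indep_vars M (\<lambda>_. borel) X UNIV \<and>
     (\<forall>j. distr M borel (X j) = distr M borel Y)"

text \<open>The sigma-algebra generated by the whole sequence \<open>X 0, X 1, \<dots>\<close>.\<close>

definition sigma_seq :: "'a measure \<Rightarrow> (nat \<Rightarrow> 'a \<Rightarrow> real) \<Rightarrow> 'a measure" where
  "sigma_seq M X =
     vimage_algebra (space M) (\<lambda>\<omega> j. X j \<omega>) (Pi\<^sub>M UNIV (\<lambda>_::nat. borel :: real measure))"

text \<open>The resampled rate \<open>\<Lambda>\<^sup>N\<close>; \<open>l j\<close> is the value of \<open>\<Lambda>\<^sub>j\<close>. For \<open>N \<ge> 1\<close> at most one term of the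
  series is nonzero.\<close>

definition resampled_rate ::
  "real \<Rightarrow> real \<Rightarrow> nat \<Rightarrow> (nat \<Rightarrow> real) \<Rightarrow> real \<Rightarrow> real" where
  "resampled_rate \<alpha> \<Delta> N l s =
     (\<Sum>j. l j * indicator {real j * \<Delta> * real N powr (-\<alpha>) ..<
                            (real j + 1) * \<Delta> * real N powr (-\<alpha>)} s)"

definition kappa :: "real \<Rightarrow> real \<Rightarrow> (real \<Rightarrow> real) \<Rightarrow> real" where
  "kappa \<mu> t f = (LINT s:{0..t}|lborel. f s * exp (- \<mu> * s))"

text \<open>Conditionally on the sub-sigma-algebra \<open>F\<close>, the variable \<open>Q\<close> is Poisson with the random
  parameter \<open>R\<close>. The library's \<open>poisson_pmf\<close> is meaningful for positive parameters only, so \<open>R\<close>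
  should be almost surely positive.\<close>

definition cond_poisson ::
  "'a measure \<Rightarrow> 'a measure \<Rightarrow> ('a \<Rightarrow> nat) \<Rightarrow> ('a \<Rightarrow> real) \<Rightarrow> bool" where
  "cond_poisson M F Q R \<longleftrightarrow>
     Q \<in> measurable M (count_space UNIV) \<and>
     (\<forall>k. AE \<omega> in M.
        real_cond_exp M F (indicator {\<omega>' \<in> space M. Q \<omega>' = k}) \<omega> = pmf (poisson_pmf (R \<omega>)) k)"

definition u_max :: "real \<Rightarrow> real \<Rightarrow> real \<Rightarrow> real" where
  "u_max y \<mu> t = y / \<mu> * (1 - exp (- \<mu> * t))"

end

theory Submission
  imports Defs "HOL-Real_Asymp.Real_Asymp"
begin

text \<open>
  The rate \<open>\<Lambda>\<^sup>N\<close> never exceeds \<open>y\<close>, and it is constantly \<open>y\<close> on \<open>[0, t]\<close> as soon as every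
  block meeting \<open>[0, t]\<close> draws the value \<open>y\<close>. There are only about \<open>N\<^sup>\<alpha>\<close> such blocks, so this
  has probability \<open>p\<close> to a power of order \<open>N\<^sup>\<alpha>\<close>. Since \<open>\<alpha> < 1\<close>, that cost vanishes on the scale
  \<open>exp (- c N)\<close>, and \<open>Q N\<close> has the same large deviations as a Poisson variable of parameter
  \<open>N u\<close>, where \<open>u\<close> is the value \<open>\<kappa>\<close> takes at the constant rate \<open>y\<close>.

  For the upper bound, the conditional parameter is at most \<open>N u\<close>, and for \<open>k \<ge> N a > N u\<close> the
  Poisson weight of \<open>k\<close> increases with the parameter as long as the parameter is below \<open>k\<close>
  (\<open>poisson_weight_mono\<close>). Hence each weight of \<open>Q N\<close> beyond \<open>N a\<close> is dominated by the
  corresponding Poisson weight, and Chernoff's bound (\<open>poisson_chernoff_sums\<close>) at the optimal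
  tilt \<open>\<theta> = ln (a / u)\<close> gives \<open>exp (N (a ln (u / a) + a - u))\<close>, without error terms.

  For the lower bound, the tail event contains the single value \<open>k = \<lceil>a N\<rceil>\<close>; conditioning on all
  relevant blocks having value \<open>y\<close> gives the explicit bound \<open>p\<^sup>J (N u)\<^sup>k exp (- N u) / k!\<close>, with
  \<open>J\<close> the number of blocks, and a one-sided Stirling estimate (\<open>ln_fact_le\<close>) shows that it has
  the same exponential rate.
\<close>

section \<open>The rate function\<close>

text \<open>The supremum is attained where the derivative \<open>a - u exp \<theta>\<close> vanishes; that this is the
  maximum is the tangent inequality \<open>1 + x \<le> exp x\<close> at \<open>x = \<theta> - ln (a / u)\<close>.\<close>

lemma poisson_legendre_transform:
  fixes a u :: real
  assumes "0 < u" "u < a"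
  shows "(SUP \<theta>\<in>{0<..}. \<theta> * a - u * (exp \<theta> - 1)) = - (a * ln (u / a) + a - u)"
proof (rule cSup_eq_maximum)
  have "exp (ln (a / u)) = a / u" "0 < ln (a / u)"
    using assms by simp_all
  moreover have "ln (a / u) = - ln (u / a)"
    using assms by (simp add: ln_div)
  ultimately have "- (a * ln (u / a) + a - u) = ln (a / u) * a - u * (exp (ln (a / u)) - 1)"
    using assms by (simp add: field_simps)
  with \<open>0 < ln (a / u)\<close>
  show "- (a * ln (u / a) + a - u) \<in> (\<lambda>\<theta>. \<theta> * a - u * (exp \<theta> - 1)) ` {0<..}"
    by blast
next
  fix z assume "z \<in> (\<lambda>\<theta>. \<theta> * a - u * (exp \<theta> - 1)) ` {0<..}"
  then obtain \<theta> where z: "z = \<theta> * a - u * (exp \<theta> - 1)"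
    by blast
  define x where "x = \<theta> + ln (u / a)"
  have "u * exp \<theta> = a * exp x"
    using assms by (simp add: x_def exp_add)
  also have "\<dots> \<ge> a * (1 + x)"
    using assms by (intro mult_left_mono exp_ge_add_one_self) auto
  finally show "z \<le> - (a * ln (u / a) + a - u)"
    by (simp add: z x_def algebra_simps)
qed

section \<open>Poisson weights\<close>

lemma poisson_weight_mono:
  fixes r s :: real
  assumes "0 < r" "r \<le> s" "s \<le> real k"
  shows "pmf (poisson_pmf r) k \<le> pmf (poisson_pmf s) k"
proof -
  have "0 < s"
    using assms by linarith
  have "real k * ln r - r \<le> real k * ln s - s"
  proof -
    have "s - r \<le> s * (ln s - ln r)"
    proof -
      have "1 - r / s \<le> - ln (r / s)"
        using ln_le_minus_one[of "r / s"] assms \<open>0 < s\<close> by simp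
      then have "s * (1 - r / s) \<le> s * - ln (r / s)"
        using \<open>0 < s\<close> by (intro mult_left_mono) auto
      then show ?thesis
        using assms \<open>0 < s\<close> by (simp add: ln_div right_diff_distrib)
    qed
    also have "\<dots> \<le> real k * (ln s - ln r)"
      using assms by (intro mult_right_mono) auto
    finally show ?thesis
      by (simp add: algebra_simps)
  qed
  then have "exp (real k * ln r - r) \<le> exp (real k * ln s - s)"
    by simp
  then have "r ^ k * exp (- r) \<le> s ^ k * exp (- s)"
    using assms(1) \<open>0 < s\<close> by (simp add: exp_diff exp_of_nat_mult exp_minus divide_inverse)
  then show ?thesis
    using assms(1) \<open>0 < s\<close> by (simp add: divide_right_mono)
qed

text \<open>The tilted weights \<open>exp (\<theta> (k - b))\<close> dominate the indicator of \<open>k \<ge> b\<close>, and their Poisson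
  sum is the moment generating function.\<close>

lemma poisson_chernoff_sums:
  fixes r \<theta> b :: real
  assumes "0 < r"
  shows "(\<lambda>k. exp (\<theta> * (real k - b)) * pmf (poisson_pmf r) k) sums
           exp (r * (exp \<theta> - 1) - \<theta> * b)"
proof -
  have "(\<lambda>k. exp (- \<theta> * b - r) * ((r * exp \<theta>) ^ k /\<^sub>R fact k)) sums
          (exp (- \<theta> * b - r) * exp (r * exp \<theta>))"
    by (intro sums_mult exp_converges)
  moreover have "exp (- \<theta> * b - r) * ((r * exp \<theta>) ^ k /\<^sub>R fact k) =
      exp (\<theta> * (real k - b)) * pmf (poisson_pmf r) k" for k
  proof -
    have "exp (\<theta> * (real k - b)) = exp \<theta> ^ k * exp (- \<theta> * b)"
      by (simp add: right_diff_distrib exp_diff exp_minus field_simps flip: exp_of_nat_mult)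
    then show ?thesis
      using assms by (simp add: exp_diff exp_minus power_mult_distrib field_simps)
  qed
  ultimately show ?thesis
    by (simp add: exp_add[symmetric] algebra_simps)
qed

text \<open>The induction step is \<open>1 \<le> (k + 2) ln ((k + 2) / (k + 1))\<close>, an instance of
  \<open>ln x \<ge> 1 - 1 / x\<close>.\<close>

lemma ln_fact_le: "ln (fact k) \<le> (real k + 1) * ln (real k + 1) - real k"
proof (induction k)
  case (Suc k)
  have "ln (fact (Suc k)) = ln (real k + 1) + ln (fact k)"
    by (simp add: ln_mult add.commute del: of_nat_Suc flip: of_nat_Suc)
  also have "\<dots> \<le> ln (real k + 1) + ((real k + 1) * ln (real k + 1) - real k)"
    using Suc by simp
  also have "\<dots> = (real k + 2) * ln (real k + 1) - real k"
    by (simp add: algebra_simps)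
  also have "\<dots> \<le> (real k + 2) * ln (real k + 2) - real k - 1"
  proof -
    have "ln ((real k + 1) / (real k + 2)) \<le> (real k + 1) / (real k + 2) - 1"
      by (intro ln_le_minus_one) auto
    also have "\<dots> = - 1 / (real k + 2)"
      by (simp add: field_simps)
    finally have "ln (real k + 1) \<le> ln (real k + 2) - 1 / (real k + 2)"
      by (simp add: ln_div)
    then have "(real k + 2) * ln (real k + 1) \<le> (real k + 2) * (ln (real k + 2) - 1 / (real k + 2))"
      by (intro mult_left_mono) auto
    then show ?thesis
      by (simp add: right_diff_distrib)
  qed
  finally show ?case
    by (simp add: add.commute)
qed simp

section \<open>The integrated rate\<close>

lemma resampled_rate_eq:
  fixes \<alpha> \<Delta> s :: real
  assumes "1 \<le> N" "0 < \<Delta>" "0 \<le> s"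
  shows "resampled_rate \<alpha> \<Delta> N l s = l (nat \<lfloor>s / (\<Delta> * real N powr (-\<alpha>))\<rfloor>)"
proof -
  define h where "h = \<Delta> * real N powr (-\<alpha>)"
  define m where "m = nat \<lfloor>s / h\<rfloor>"
  have "0 < h"
    using assms by (simp add: h_def)
  then have m: "real j * h \<le> s \<and> s < (real j + 1) * h \<longleftrightarrow> j = m" for j
  proof -
    have "real j * h \<le> s \<and> s < (real j + 1) * h \<longleftrightarrow> real j \<le> s / h \<and> s / h < real j + 1"
      using \<open>0 < h\<close> by (simp add: pos_le_divide_eq pos_divide_less_eq)
    also have "\<dots> \<longleftrightarrow> \<lfloor>s / h\<rfloor> = int j"
      by (simp add: floor_eq_iff)
    also have "\<dots> \<longleftrightarrow> j = m"
      using \<open>0 < h\<close> assms(3) by (auto simp: m_def)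
    finally show ?thesis .
  qed
  have "resampled_rate \<alpha> \<Delta> N l s = (\<Sum>j. l j * indicator {real j * h ..< (real j + 1) * h} s)"
    by (simp add: resampled_rate_def h_def mult.assoc)
  also have "\<dots> = (\<Sum>j\<in>{m}. l j * indicator {real j * h ..< (real j + 1) * h} s)"
    by (intro suminf_finite) (auto simp: indicator_def m)
  also have "\<dots> = l m"
    using m[of m] by (simp add: indicator_def)
  finally show ?thesis
    by (simp add: m_def h_def)
qed

lemma kappa_const:
  fixes \<mu> t y :: real
  assumes "0 < \<mu>" "0 \<le> t"
  shows "kappa \<mu> t (\<lambda>_. y) = u_max y \<mu> t"
    and "set_integrable lborel {0..t} (\<lambda>s. y * exp (- \<mu> * s))"
proof -
  have "has_bochner_integral lborel (\<lambda>s. indicator {0..t} s *\<^sub>R (y * exp (- \<mu> * s)))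
          (- (y / \<mu>) * exp (- \<mu> * t) - - (y / \<mu>) * exp (- \<mu> * 0))"
    using assms
    by (intro has_bochner_integral_FTC_Icc)
       (auto intro!: derivative_eq_intros continuous_intros
             simp flip: has_real_derivative_iff_has_vector_derivative)
  moreover have "- (y / \<mu>) * exp (- \<mu> * t) - - (y / \<mu>) * exp (- \<mu> * 0) = u_max y \<mu> t"
    by (simp add: u_max_def algebra_simps)
  ultimately show "kappa \<mu> t (\<lambda>_. y) = u_max y \<mu> t"
    and "set_integrable lborel {0..t} (\<lambda>s. y * exp (- \<mu> * s))"
    by (simp_all only: has_bochner_integral_iff kappa_def set_lebesgue_integral_def
          set_integrable_def)
qed

lemma kappa_resampled_rate_const:
  fixes \<alpha> \<Delta> \<mu> t y :: real
  assumes "1 \<le> N" "0 < \<Delta>" "0 < \<mu>" "0 < t"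
    and "\<And>j. j \<le> nat \<lfloor>t / (\<Delta> * real N powr (-\<alpha>))\<rfloor> \<Longrightarrow> l j = y"
  shows "kappa \<mu> t (resampled_rate \<alpha> \<Delta> N l) = u_max y \<mu> t"
proof -
  have "resampled_rate \<alpha> \<Delta> N l s = y" if "s \<in> {0..t}" for s
  proof -
    have "s / (\<Delta> * real N powr (-\<alpha>)) \<le> t / (\<Delta> * real N powr (-\<alpha>))"
      using that assms by (intro divide_right_mono) auto
    then have "nat \<lfloor>s / (\<Delta> * real N powr (-\<alpha>))\<rfloor> \<le> nat \<lfloor>t / (\<Delta> * real N powr (-\<alpha>))\<rfloor>"
      by (intro nat_mono floor_mono)
    then show ?thesis
      using that assms by (simp add: resampled_rate_eq)
  qed
  then have "kappa \<mu> t (resampled_rate \<alpha> \<Delta> N l) = kappa \<mu> t (\<lambda>_. y)"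
    unfolding kappa_def by (intro set_lebesgue_integral_cong) auto
  then show ?thesis
    using assms by (simp add: kappa_const)
qed

text \<open>Strict positivity matters because \<open>poisson_pmf\<close> is the Poisson law for positive parameters
  only. It holds since just finitely many blocks meet \<open>[0, t]\<close>, so that the rate is bounded below
  by the minimum of their values.\<close>

lemma kappa_resampled_rate_bounds:
  fixes \<alpha> \<Delta> \<mu> t y :: real
  assumes N: "1 \<le> N" and pos: "0 < \<Delta>" "0 < \<mu>" "0 < t"
    and l: "\<And>j. 0 < l j" "\<And>j. l j \<le> y"
  shows "0 < kappa \<mu> t (resampled_rate \<alpha> \<Delta> N l)"
    and "kappa \<mu> t (resampled_rate \<alpha> \<Delta> N l) \<le> u_max y \<mu> t"
proof -
  define h where "h = \<Delta> * real N powr (-\<alpha>)"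
  have "0 < h"
    using N pos by (simp add: h_def)
  define m where "m = Min (l ` {..nat \<lfloor>t / h\<rfloor>})"
  have "0 < m"
    using l by (simp add: m_def)
  have rate: "resampled_rate \<alpha> \<Delta> N l s = l (nat \<lfloor>s / h\<rfloor>)" if "s \<in> {0..t}" for s
    using that N pos by (simp add: resampled_rate_eq h_def)
  have m_le: "m \<le> l (nat \<lfloor>s / h\<rfloor>)" if "s \<in> {0..t}" for s
  proof -
    have "s / h \<le> t / h"
      using that \<open>0 < h\<close> by (intro divide_right_mono) auto
    then have "nat \<lfloor>s / h\<rfloor> \<le> nat \<lfloor>t / h\<rfloor>"
      by (intro nat_mono floor_mono)
    then show ?thesis
      by (simp add: m_def)
  qed
  have kappa: "kappa \<mu> t (resampled_rate \<alpha> \<Delta> N l) = kappa \<mu> t (\<lambda>s. l (nat \<lfloor>s / h\<rfloor>))"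
    unfolding kappa_def by (intro set_lebesgue_integral_cong) (auto simp: rate)
  have [measurable]: "(\<lambda>s. l (nat \<lfloor>s / h\<rfloor>)) \<in> borel_measurable borel"
    by (rule measurable_compose[where N = "count_space UNIV"]) measurable
  have int: "set_integrable lborel {0..t} (\<lambda>s. l (nat \<lfloor>s / h\<rfloor>) * exp (- \<mu> * s))"
    using kappa_const(2)[of \<mu> t y]
  proof (rule set_integrable_bound)
    show "AE s in lborel. s \<in> {0..t} \<longrightarrow>
        norm (l (nat \<lfloor>s / h\<rfloor>) * exp (- \<mu> * s)) \<le> norm (y * exp (- \<mu> * s))"
      using l by (intro AE_I2) (auto simp: abs_mult intro!: mult_right_mono order.trans[OF _ abs_ge_self]
        simp: abs_of_pos)
  qed (use pos in \<open>auto simp: set_borel_measurable_def\<close>)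
  have "kappa \<mu> t (\<lambda>_. m) \<le> kappa \<mu> t (\<lambda>s. l (nat \<lfloor>s / h\<rfloor>))"
    unfolding kappa_def using pos m_le
    by (intro set_integral_mono int kappa_const(2)) auto
  moreover have "0 < u_max m \<mu> t"
    using \<open>0 < m\<close> pos by (simp add: u_max_def)
  ultimately show "0 < kappa \<mu> t (resampled_rate \<alpha> \<Delta> N l)"
    using pos by (simp add: kappa kappa_const)
  have "kappa \<mu> t (\<lambda>s. l (nat \<lfloor>s / h\<rfloor>)) \<le> kappa \<mu> t (\<lambda>_. y)"
    unfolding kappa_def using pos l
    by (intro set_integral_mono int kappa_const(2)) auto
  then show "kappa \<mu> t (resampled_rate \<alpha> \<Delta> N l) \<le> u_max y \<mu> t"
    using pos by (simp add: kappa kappa_const)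
qed

section \<open>Conditionally Poisson variables\<close>

lemma subalgebra_sigma_seq:
  assumes "\<And>j. X j \<in> borel_measurable M"
  shows "subalgebra M (sigma_seq M X)"
  unfolding subalgebra_def sigma_seq_def
proof
  have "(\<lambda>\<omega> j. X j \<omega>) \<in> measurable M (Pi\<^sub>M UNIV (\<lambda>_. borel))"
    using assms by (intro measurable_PiM_single') (auto simp: space_PiM)
  then show "sets (vimage_algebra (space M) (\<lambda>\<omega> j. X j \<omega>) (Pi\<^sub>M UNIV (\<lambda>_. borel))) \<subseteq> sets M"
    by (intro sets_image_in_sets) auto
qed simp

context
  fixes M F :: "'a measure" and Q :: "'a \<Rightarrow> nat" and R :: "'a \<Rightarrow> real"
  assumes M: "prob_space M" and F: "subalgebra M F" and Q: "cond_poisson M F Q R"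
begin

lemma cond_poisson_integral:
  fixes k :: nat
  shows "integrable M (real_cond_exp M F (indicator {\<omega> \<in> space M. Q \<omega> = k}))"
    and "measure M {\<omega> \<in> space M. Q \<omega> = k} =
           (\<integral>\<omega>. real_cond_exp M F (indicator {\<omega> \<in> space M. Q \<omega> = k}) \<omega> \<partial>M)"
proof -
  interpret prob_space M by (fact M)
  interpret finite_measure_subalgebra M F
    by unfold_locales (fact F)
  have [measurable]: "Q \<in> measurable M (count_space UNIV)"
    using Q by (simp add: cond_poisson_def)
  have *: "integrable M (indicator {\<omega> \<in> space M. Q \<omega> = k} :: 'a \<Rightarrow> real)"
    by (intro integrable_real_indicator) (auto simp: emeasure_eq_measure)
  show "integrable M (real_cond_exp M F (indicator {\<omega> \<in> space M. Q \<omega> = k}))"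
    using * by (rule real_cond_exp_int)
  show "measure M {\<omega> \<in> space M. Q \<omega> = k} =
           (\<integral>\<omega>. real_cond_exp M F (indicator {\<omega> \<in> space M. Q \<omega> = k}) \<omega> \<partial>M)"
    using real_cond_exp_int(2)[OF *] by simp
qed

lemma cond_poisson_weight_le:
  assumes "AE \<omega> in M. pmf (poisson_pmf (R \<omega>)) k \<le> c"
  shows "measure M {\<omega> \<in> space M. Q \<omega> = k} \<le> c"
proof -
  interpret prob_space M by (fact M)
  have "AE \<omega> in M. real_cond_exp M F (indicator {\<omega> \<in> space M. Q \<omega> = k}) \<omega> =
          pmf (poisson_pmf (R \<omega>)) k"
    using Q by (auto simp: cond_poisson_def)
  with assms have "AE \<omega> in M. real_cond_exp M F (indicator {\<omega> \<in> space M. Q \<omega> = k}) \<omega> \<le> c"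
    by eventually_elim simp
  then have "(\<integral>\<omega>. real_cond_exp M F (indicator {\<omega> \<in> space M. Q \<omega> = k}) \<omega> \<partial>M) \<le> (\<integral>\<omega>. c \<partial>M)"
    by (intro integral_mono_AE cond_poisson_integral) auto
  then show ?thesis
    by (simp add: cond_poisson_integral(2) prob_space)
qed

lemma cond_poisson_weight_ge:
  assumes "E \<in> sets M" "\<And>\<omega>. \<omega> \<in> E \<Longrightarrow> c \<le> pmf (poisson_pmf (R \<omega>)) k"
  shows "measure M E * c \<le> measure M {\<omega> \<in> space M. Q \<omega> = k}"
proof -
  interpret prob_space M by (fact M)
  have "AE \<omega> in M. real_cond_exp M F (indicator {\<omega> \<in> space M. Q \<omega> = k}) \<omega> =
          pmf (poisson_pmf (R \<omega>)) k"
    using Q by (auto simp: cond_poisson_def)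
  then have "AE \<omega> in M. indicator E \<omega> * c \<le>
      real_cond_exp M F (indicator {\<omega> \<in> space M. Q \<omega> = k}) \<omega>"
    by eventually_elim (auto simp: indicator_def assms(2))
  then have "(\<integral>\<omega>. indicator E \<omega> * c \<partial>M) \<le>
      (\<integral>\<omega>. real_cond_exp M F (indicator {\<omega> \<in> space M. Q \<omega> = k}) \<omega> \<partial>M)"
    using assms(1)
    by (intro integral_mono_AE cond_poisson_integral integrable_mult_left integrable_real_indicator)
       (auto simp: emeasure_eq_measure)
  then show ?thesis
    using assms(1) by (simp add: cond_poisson_integral(2))
qed

text \<open>The weights beyond \<open>b\<close> are compared one at a time with those of the fixed parameter \<open>v\<close>,
  which needs \<open>v \<le> b\<close> for \<open>poisson_weight_mono\<close>.\<close>

lemma cond_poisson_tail_le: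
  fixes v b \<theta> :: real
  assumes R: "AE \<omega> in M. 0 < R \<omega> \<and> R \<omega> \<le> v" and "0 < v" "v \<le> b" "0 \<le> \<theta>"
  shows "measure M {\<omega> \<in> space M. b \<le> real (Q \<omega>)} \<le> exp (v * (exp \<theta> - 1) - \<theta> * b)"
proof -
  interpret prob_space M by (fact M)
  have [measurable]: "Q \<in> measurable M (count_space UNIV)"
    using Q by (simp add: cond_poisson_def)
  define A where "A k = {\<omega> \<in> space M. Q \<omega> = k \<and> b \<le> real k}" for k
  have "(\<lambda>k. measure M (A k)) sums measure M (\<Union>k. A k)"
    by (intro finite_measure_UNION) (auto simp: A_def disjoint_family_on_def)
  moreover have "(\<Union>k. A k) = {\<omega> \<in> space M. b \<le> real (Q \<omega>)}"
    by (auto simp: A_def)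
  ultimately have tail: "(\<lambda>k. measure M (A k)) sums measure M {\<omega> \<in> space M. b \<le> real (Q \<omega>)}"
    by simp
  have dominated: "measure M (A k) \<le> exp (\<theta> * (real k - b)) * pmf (poisson_pmf v) k" for k
  proof (cases "b \<le> real k")
    case True
    have "AE \<omega> in M. pmf (poisson_pmf (R \<omega>)) k \<le> pmf (poisson_pmf v) k"
      using R by eventually_elim (use True assms in \<open>intro poisson_weight_mono; linarith\<close>)
    then have "measure M (A k) \<le> pmf (poisson_pmf v) k"
      using True cond_poisson_weight_le by (simp add: A_def)
    also have "\<dots> \<le> exp (\<theta> * (real k - b)) * pmf (poisson_pmf v) k"
    proof -
      have "1 \<le> exp (\<theta> * (real k - b))"
        using True assms(4) by simp
      from mult_right_mono[OF this pmf_nonneg] show ?thesis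
        by (simp only: mult_1_left)
    qed
    finally show ?thesis .
  qed (simp add: A_def)
  show ?thesis
    by (rule sums_le[OF dominated tail poisson_chernoff_sums[OF \<open>0 < v\<close>]])
qed

end

section \<open>The environment\<close>

lemma iid_copies_AE_all:
  assumes M: "prob_space M" and iid: "iid_copies M X Y" and [measurable]: "Y \<in> borel_measurable M"
    and [measurable]: "Measurable.pred borel P" and "AE \<omega> in M. P (Y \<omega>)"
  shows "AE \<omega> in M. \<forall>j. P (X j \<omega>)"
  unfolding AE_all_countable
proof
  interpret prob_space M by (fact M)
  fix j
  have [measurable]: "X j \<in> borel_measurable M"
    using iid by (auto simp: iid_copies_def indep_vars_def)
  have "AE x in distr M borel Y. P x"
    using assms(5) by (subst AE_distr_iff) auto
  moreover have "distr M borel Y = distr M borel (X j)"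
    using iid by (simp add: iid_copies_def)
  ultimately have "AE x in distr M borel (X j). P x"
    by (simp only:)
  then show "AE \<omega> in M. P (X j \<omega>)"
    by (subst (asm) AE_distr_iff) auto
qed

lemma iid_copies_prob_all_eq:
  fixes y :: real
  assumes M: "prob_space M" and iid: "iid_copies M X Y" and [measurable]: "Y \<in> borel_measurable M"
  shows "measure M {\<omega> \<in> space M. \<forall>j\<le>m. X j \<omega> = y} =
           measure M {\<omega> \<in> space M. Y \<omega> = y} ^ Suc m"
proof -
  interpret prob_space M by (fact M)
  have [measurable]: "X j \<in> borel_measurable M" for j
    using iid by (auto simp: iid_copies_def indep_vars_def)
  have eq: "prob (X j -` {y} \<inter> space M) = prob {\<omega> \<in> space M. Y \<omega> = y}" for j
  proof -
    have "prob (X j -` {y} \<inter> space M) = measure (distr M borel (X j)) {y}"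
      by (simp add: measure_distr)
    also have "distr M borel (X j) = distr M borel Y"
      using iid by (simp add: iid_copies_def)
    also have "measure (distr M borel Y) {y} = prob {\<omega> \<in> space M. Y \<omega> = y}"
      by (simp add: measure_distr vimage_def Int_def conj_commute)
    finally show ?thesis .
  qed
  have "{\<omega> \<in> space M. \<forall>j\<le>m. X j \<omega> = y} = (\<Inter>j\<in>{..m}. X j -` {y} \<inter> space M)"
    by auto
  also have "prob \<dots> = (\<Prod>j\<in>{..m}. prob (X j -` {y} \<inter> space M))"
    using iid by (intro indep_varsD[where I = UNIV and M' = "\<lambda>_. borel"])
      (auto simp: iid_copies_def)
  finally show ?thesis
    by (simp add: eq)
qed

section \<open>The exponential rate of the lower bound\<close>

text \<open>Replacing the rounded integers \<open>m\<close> and \<open>k\<close> by their real bounds leaves a smooth expression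
  in \<open>N\<close> whose limit is a routine asymptotic computation. The hypothesis \<open>1 \<le> v\<close> makes \<open>v ^ k\<close>
  monotone in \<open>k\<close>.\<close>

lemma ln_poisson_point_ge:
  fixes p v b J :: real
  assumes "0 < p" "p < 1" "1 \<le> v" "0 < b" "real m \<le> J" "b \<le> real k" "real k \<le> b + 1"
  shows "J * ln p + (- v + b * ln v - ((b + 2) * ln (b + 2) - b))
           \<le> ln (p ^ m * pmf (poisson_pmf v) k)"
proof -
  have "ln (p ^ m * pmf (poisson_pmf v) k) = real m * ln p + (real k * ln v - ln (fact k) - v)"
    using assms by (simp add: ln_mult ln_div ln_realpow)
  moreover have "J * ln p \<le> real m * ln p"
    using assms by (intro mult_right_mono_neg) auto
  moreover have "b * ln v \<le> real k * ln v"
    using assms by (intro mult_right_mono) auto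
  moreover have "(real k + 1) * ln (real k + 1) \<le> (b + 2) * ln (b + 2)"
    using assms by (intro mult_mono) auto
  ultimately show ?thesis
    using ln_fact_le[of k] assms by linarith
qed

lemma lower_bound_tendsto:
  fixes \<alpha> c p a u :: real
  assumes "0 < \<alpha>" "\<alpha> < 1" "0 < c" "0 < a" "0 < u"
  shows "(\<lambda>N. ((c * real N powr \<alpha> + 2) * ln p + (- (real N * u) + real N * a * ln (real N * u)
              - ((real N * a + 2) * ln (real N * a + 2) - real N * a))) / real N)
           \<longlonglongrightarrow> a * ln (u / a) + a - u"
proof -
  have "(\<lambda>N. (c * real N powr \<alpha> + 2) * ln p / real N) \<longlonglongrightarrow> 0"
    using assms by real_asymp
  moreover have "(\<lambda>N. (- (real N * u) + real N * a * ln (real N * u)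
      - ((real N * a + 2) * ln (real N * a + 2) - real N * a)) / real N)
      \<longlonglongrightarrow> a * ln u - u - (a * ln a - a)"
    using assms by real_asymp
  moreover have "a * ln u - u - (a * ln a - a) = a * ln (u / a) + a - u"
    using assms by (simp add: ln_div algebra_simps)
  ultimately show ?thesis
    unfolding add_divide_distrib using tendsto_add by fastforce
qed

section \<open>The large deviation limit\<close>

theorem mainTheorem5:
  fixes M :: "'a measure"
    and \<Lambda> :: "'a \<Rightarrow> real" and \<Lambda>s :: "nat \<Rightarrow> 'a \<Rightarrow> real"
    and Q :: "nat \<Rightarrow> 'a \<Rightarrow> nat"
    and S :: "real set"
    and \<alpha> \<Delta> \<mu> t y y' p a :: real
  assumes "prob_space M"
    and "0 < \<alpha>" "\<alpha> < 1" "0 < \<Delta>" "0 < \<mu>" "0 < t"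
    and "\<Lambda> \<in> borel_measurable M"
    and "AE \<omega> in M. \<Lambda> \<omega> \<in> S"
    and "\<And>x. x \<in> S \<Longrightarrow> x isolated_in S" "\<And>x. x \<in> S \<Longrightarrow> 0 < x"
    and "y \<in> S" "measure M {\<omega> \<in> space M. \<Lambda> \<omega> = y} = p" "0 < p" "p < 1"
    and "y' \<in> S" "y' < y" "\<And>x. x \<in> S \<Longrightarrow> x \<noteq> y \<Longrightarrow> x \<le> y'"
    and "iid_copies M \<Lambda>s \<Lambda>"
    and "\<And>N. 1 \<le> N \<Longrightarrow>
           cond_poisson M (sigma_seq M \<Lambda>s) (Q N)
             (\<lambda>\<omega>. real N * kappa \<mu> t (resampled_rate \<alpha> \<Delta> N (\<lambda>j. \<Lambda>s j \<omega>)))"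
    and "u_max y \<mu> t < a"
  shows "((\<lambda>N. 1 / real N * ln (measure M {\<omega> \<in> space M. a \<le> real (Q N \<omega>) / real N}))
            \<longlonglongrightarrow> - (SUP \<theta>\<in>{0<..}. \<theta> * a - u_max y \<mu> t * (exp \<theta> - 1))) \<and>
         - (SUP \<theta>\<in>{0<..}. \<theta> * a - u_max y \<mu> t * (exp \<theta> - 1))
            = a * ln (u_max y \<mu> t / a) + a - u_max y \<mu> t"
proof -
  interpret prob_space M by fact
  define u where "u = u_max y \<mu> t"
  define R where "R N \<omega> = real N * kappa \<mu> t (resampled_rate \<alpha> \<Delta> N (\<lambda>j. \<Lambda>s j \<omega>))" for N \<omega>
  define I where "I = a * ln (u / a) + a - u"
  define P where "P N = measure M {\<omega> \<in> space M. a \<le> real (Q N \<omega>) / real N}" for N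
  define L where "L N = (t / \<Delta> * real N powr \<alpha> + 2) * ln p +
      (- (real N * u) + real N * a * ln (real N * u)
       - ((real N * a + 2) * ln (real N * a + 2) - real N * a))" for N :: nat
  note [measurable] = \<open>\<Lambda> \<in> borel_measurable M\<close>
  have "0 < y"
    using assms by blast
  then have "0 < u"
    using \<open>0 < \<mu>\<close> \<open>0 < t\<close> by (simp add: u_def u_max_def)
  have "u < a"
    using assms by (simp add: u_def)
  have X[measurable]: "\<Lambda>s j \<in> borel_measurable M" for j
    using \<open>iid_copies M \<Lambda>s \<Lambda>\<close> by (auto simp: iid_copies_def indep_vars_def)
  have sub: "subalgebra M (sigma_seq M \<Lambda>s)"
    by (rule subalgebra_sigma_seq) (rule X)
  have Q: "cond_poisson M (sigma_seq M \<Lambda>s) (Q N) (R N)" if "1 \<le> N" for N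
    using assms that unfolding R_def by blast
  have "AE \<omega> in M. 0 < \<Lambda> \<omega> \<and> \<Lambda> \<omega> \<le> y"
    using \<open>AE \<omega> in M. \<Lambda> \<omega> \<in> S\<close> by eventually_elim (use assms in force)
  then have env: "AE \<omega> in M. \<forall>j. 0 < \<Lambda>s j \<omega> \<and> \<Lambda>s j \<omega> \<le> y"
    by (intro iid_copies_AE_all[OF \<open>prob_space M\<close> \<open>iid_copies M \<Lambda>s \<Lambda>\<close>]) auto
  have tail: "P N = measure M {\<omega> \<in> space M. real N * a \<le> real (Q N \<omega>)}" if "1 \<le> N" for N
    using that by (simp add: P_def pos_le_divide_eq mult.commute)

  have upper: "P N \<le> exp (real N * I)" if N: "1 \<le> N" for N
  proof -
    have "AE \<omega> in M. 0 < R N \<omega> \<and> R N \<omega> \<le> real N * u"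
      using env
    proof eventually_elim
      case (elim \<omega>)
      then show ?case
        using N assms kappa_resampled_rate_bounds[of N \<Delta> \<mu> t "\<lambda>j. \<Lambda>s j \<omega>" y \<alpha>]
        by (auto simp: R_def u_def)
    qed
    then have "measure M {\<omega> \<in> space M. real N * a \<le> real (Q N \<omega>)} \<le>
        exp (real N * u * (exp (ln (a / u)) - 1) - ln (a / u) * (real N * a))"
      using N \<open>0 < u\<close> \<open>u < a\<close>
      by (intro cond_poisson_tail_le[OF \<open>prob_space M\<close> sub Q]) auto
    also have "real N * u * (exp (ln (a / u)) - 1) - ln (a / u) * (real N * a) = real N * I"
    proof -
      have "exp (ln (a / u)) = a / u"
        using \<open>0 < u\<close> \<open>u < a\<close> by simp
      moreover have "ln (a / u) = - ln (u / a)"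
        using \<open>0 < u\<close> \<open>u < a\<close> by (simp add: ln_div)
      ultimately show ?thesis
        using \<open>0 < u\<close> by (simp add: I_def field_simps)
    qed
    finally show ?thesis
      using N by (simp add: tail)
  qed

  have lower: "0 < P N \<and> L N \<le> ln (P N)" if N: "1 \<le> N" "1 \<le> real N * u" for N
  proof -
    define m where "m = nat \<lfloor>t / (\<Delta> * real N powr (-\<alpha>))\<rfloor>"
    define k where "k = nat \<lceil>real N * a\<rceil>"
    define E where "E = {\<omega> \<in> space M. \<forall>j\<le>m. \<Lambda>s j \<omega> = y}"
    have "0 < real N * a"
      using N \<open>0 < u\<close> \<open>u < a\<close> by simp
    then have k: "real N * a \<le> real k" "real k \<le> real N * a + 1"
      unfolding k_def by linarith+
    have "real m \<le> t / (\<Delta> * real N powr (-\<alpha>))"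
      using assms by (simp add: m_def)
    also have "\<dots> = t / \<Delta> * real N powr \<alpha>"
      by (simp add: powr_minus divide_inverse)
    finally have m: "real (Suc m) \<le> t / \<Delta> * real N powr \<alpha> + 2"
      by simp
    have [measurable]: "E \<in> sets M"
      unfolding E_def by measurable
    have "measure M E = p ^ Suc m"
      using iid_copies_prob_all_eq[OF \<open>prob_space M\<close> \<open>iid_copies M \<Lambda>s \<Lambda>\<close>] assms
      by (simp add: E_def)
    moreover have "R N \<omega> = real N * u" if "\<omega> \<in> E" for \<omega>
      using that N assms kappa_resampled_rate_const[of N \<Delta> \<mu> t \<alpha> "\<lambda>j. \<Lambda>s j \<omega>" y]
      by (auto simp: R_def u_def E_def m_def)
    ultimately have "p ^ Suc m * pmf (poisson_pmf (real N * u)) k \<le>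
        measure M {\<omega> \<in> space M. Q N \<omega> = k}"
      using cond_poisson_weight_ge[OF \<open>prob_space M\<close> sub Q[OF N(1)], of E] by simp
    also have "\<dots> \<le> P N"
    proof -
      have [measurable]: "Q N \<in> measurable M (count_space UNIV)"
        using Q[OF N(1)] by (simp add: cond_poisson_def)
      show ?thesis
        unfolding tail[OF N(1)] using k by (intro finite_measure_mono) auto
    qed
    finally have le: "p ^ Suc m * pmf (poisson_pmf (real N * u)) k \<le> P N" .
    have "0 < p ^ Suc m * pmf (poisson_pmf (real N * u)) k"
      using N \<open>0 < p\<close> by simp
    with le have "0 < P N"
      and "ln (p ^ Suc m * pmf (poisson_pmf (real N * u)) k) \<le> ln (P N)"
      by simp_all
    moreover have "L N \<le> ln (p ^ Suc m * pmf (poisson_pmf (real N * u)) k)"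
      unfolding L_def using \<open>0 < p\<close> \<open>p < 1\<close> N(2) \<open>0 < real N * a\<close> m k
      by (rule ln_poisson_point_ge)
    ultimately show ?thesis
      by linarith
  qed

  have large: "\<forall>\<^sub>F N in sequentially. 1 \<le> N \<and> 1 \<le> real N * u"
  proof (rule eventually_conj)
    show "\<forall>\<^sub>F N in sequentially. 1 \<le> real N * u"
      using \<open>0 < u\<close> by real_asymp
  qed (rule eventually_ge_at_top)
  have "(\<lambda>N. 1 / real N * ln (P N)) \<longlonglongrightarrow> I"
  proof (rule tendsto_sandwich)
    show "(\<lambda>N. L N / real N) \<longlonglongrightarrow> I"
      unfolding L_def I_def
      using assms \<open>0 < u\<close> \<open>u < a\<close> by (intro lower_bound_tendsto) auto
    show "\<forall>\<^sub>F N in sequentially. L N / real N \<le> 1 / real N * ln (P N)"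
      using large by eventually_elim (use lower in \<open>auto simp: divide_right_mono\<close>)
    show "\<forall>\<^sub>F N in sequentially. 1 / real N * ln (P N) \<le> I"
      using large
    proof eventually_elim
      case (elim N)
      then have "ln (P N) \<le> real N * I"
        using lower[of N] upper[of N] by (metis ln_exp ln_le_cancel_iff exp_gt_zero)
      then show ?case
        using elim by (simp add: pos_divide_le_eq mult.commute)
    qed
  qed simp
  then show ?thesis
    using poisson_legendre_transform[OF \<open>0 < u\<close> \<open>u < a\<close>]
    by (simp add: P_def I_def u_def)
qed

end
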